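(* Let $i\in\{1,2,3\}$. For any $n\in\mathbb{Z}_{\ge1}$, $$(\Psi_{i,1})^n(F_i)=\varphi([i]S^{n-1}),\qquad \Psi_{[i]T}^{T}(F_i)=\varphi([i]T),\qquad \Psi_{[i]S^nT}^{T}\bigl(\varphi([i]S^{n-1})\bigr)=\varphi([i]S^nT).$$ For any $\mathbf{w}\in\mathcal{T}^{\ge[i]}$, the set $\varphi(\mathbf{w})$ is obtained by applying $\Psi_{i,1}$, $\Psi_{[i]T}^{S}$ and $\Psi_{[i]T}^{T}$ to $F_i$ as follows: (a) If $\mathbf{w}=[i]S^n$ with $n\in\mathbb{Z}_{\ge0}$, then $\varphi(\mathbf{w})=(\Psi_{i,1})^{n+1}(F_i)$. (b) If $\mathbf{w}=[i]S^nTM_1M_2\cdots M_r$ with $n,r\in\mathbb{Z}_{\ge0}$ and $M_1,\dots,M_r\in\{S,T\}$, then $$\varphi(\mathbf{w})=(\Psi_{i,1})^n\,\Psi_{[i]T}^{M_1}\cdots\Psi_{[i]T}^{M_r}\,\Psi_{[i]T}^{T}(F_i).$$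
   Context: Fix $p,p',q,q',r,r'\in\mathbb{R}_{>0}$ with $pp'=qq'=rr'=4$ and $pqr=p'q'r'$, a global sign, and $B=\pm\begin{pmatrix}0&-p'&r\\ p&0&-q'\\ -r'&q&0\end{pmatrix}$ ($B$-invariant type). Fix $D=\mathrm{diag}(d_1,d_2,d_3)$ with $d_i>0$ and $DB$ skew-symmetric. A sequence $\mathbf{w}=[k_1,\dots,k_n]$ of elements of $\{1,2,3\}$ is reduced if $k_j\neq k_{j+1}$ for all $j$; $|\mathbf w|=n$; $\mathcal{T}$ is the set of all reduced sequences, including the empty one $\emptyset$; for $k\ne k_n$, $\mathbf{w}[k]=[k_1,\dots,k_n,k]$. Put $B^{\mathbf{w}}=(b_{ij}^{\mathbf{w}})=(-1)^{|\mathbf{w}|}B$. $\mathcal{T}^{\ge[i]}$ is the set of reduced sequences starting with $i$. The $c$-vectors $\mathbf{c}_j^{\mathbf{w}}=(c_{ij}^{\mathbf{w}})_{i=1}^3$ and $g$-vectors $\mathbf{g}_j^{\mathbf{w}}=(g_{ij}^{\mathbf{w}})_{i=1}^3$ in $\mathbb{R}^3$ are defined by $\mathbf{c}_j^{\emptyset}=\mathbf{g}_j^{\emptyset}=\mathbf{e}_j$ and: $c_{ik}^{\mathbf{w}[k]}=-c_{ik}^{\mathbf{w}}$; $c_{ij}^{\mathbf{w}[k]}=c_{ij}^{\mathbf{w}}+c_{ik}^{\mathbf{w}}\max(b_{kj}^{\mathbf{w}},0)+\max(-c_{ik}^{\mathbf{w}},0)b_{kj}^{\mathbf{w}}$ for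 $j\ne k$; $g_{ij}^{\mathbf{w}[k]}=g_{ij}^{\mathbf{w}}$ for $j\neq k$; $g_{ik}^{\mathbf{w}[k]}=-g_{ik}^{\mathbf{w}}+\sum_{l}g_{il}^{\mathbf{w}}\max(-b_{lk}^{\mathbf{w}},0)-\sum_l b_{il}^{\emptyset}\max(-c_{lk}^{\mathbf{w}},0)$. The modified $g$-vectors are $\tilde{\mathbf{g}}_j^{\mathbf{w}}=d_j^{-1/2}\mathbf{g}_j^{\mathbf{w}}$; $\tilde{\mathbf{e}}_j=d_j^{-1/2}\mathbf{e}_j$. It is known that each $\mathbf{c}_j^{\mathbf{w}}$ is nonzero with all entries $\ge0$ or all entries $\le0$; let $\varepsilon_j^{\mathbf{w}}\in\{\pm1\}$ be its sign. For $\mathbf{w}\neq\emptyset$ define $K(\mathbf{w}),S(\mathbf{w}),T(\mathbf{w})$ with $\{K(\mathbf w),S(\mathbf w),T(\mathbf w)\}=\{1,2,3\}$: $k=K(\mathbf{w})$ is the last index of $\mathbf{w}$; $s=S(\mathbf{w})$ is the (known to be unique) index $s\ne k$ with $\varepsilon_s^{\mathbf{w}}\neq\varepsilon_k^{\mathbf{w}}$ and $\varepsilon_s^{\mathbf{w}}b_{ks}^{\mathbf{w}}<0$; $T(\mathbf{w})$ is the remaining index. For $M\in\{K,S,T\}$ write $\tilde{\mathbf{g}}_M^{\mathbf{w}}=\tilde{\mathbf{g}}_{M(\mathbf{w})}^{\mathbf{w}}$. $\mathcal{M}$ is the free monoid on two letters $S,T$, acting on the right on $\mathcal{T}\setminus\{\emptyset\}$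 by $\mathbf{w}S=\mathbf{w}[S(\mathbf{w})]$, $\mathbf{w}T=\mathbf{w}[T(\mathbf{w})]$. Every $\mathbf{w}\ne\emptyset$ is uniquely $[i]X$, $X\in\mathcal{M}$; it is in a branch if $X$ contains at least one letter $T$. For $i\in\{1,2,3\}$ put $k_0=K([i])=i$, $s_0=S([i])$, $t_0=T([i])$, $\mathfrak{g}_i=\tilde{\mathbf{e}}_{s_0}+\tilde{\mathbf{e}}_{t_0}-\tilde{\mathbf{e}}_{k_0}$. For vectors $\mathbf{a}_1,\dots,\mathbf{a}_n$ put $\mathcal{C}^{\circ}(\mathbf{a}_1,\dots,\mathbf{a}_n)=\{\sum\lambda_j\mathbf{a}_j\mid\lambda_j>0\}$. For $\mathbf{w}\in\mathcal{T}^{\ge[i]}$ put $\varphi(\mathbf{w})=\mathcal{C}^{\circ}(\tilde{\mathbf{g}}_K^{\mathbf{w}},\tilde{\mathbf{g}}_K^{\mathbf{w}}-\mathfrak{g}_i)$, and $F_i=\mathcal{C}^{\circ}(\tilde{\mathbf{e}}_{s_0},\tilde{\mathbf{e}}_{k_0}-\tilde{\mathbf{e}}_{t_0})$. (These sets, $F_i$ and $\varphi(\mathbf w)$ for $\mathbf{w}\in\mathcal{T}^{\ge[i]}$, are the connected components of the complement of the support of the $G$-fan attached to the initial direction $i$.) For $\mathbf{w}$ in a branch and $X\in\mathcal{M}$, $\Psi_{\mathbf{w}}^{X}\in\mathrm{GL}(\mathbb{R}^3)$ is the unique linear map with $\Psi_{\mathbf{w}}^X(\tilde{\mathbf{g}}_M^{\mathbf{w}})=\tilde{\mathbf{g}}_M^{\mathbf{w}X}$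 for $M=K,S,T$ (the $\tilde{\mathbf{g}}_M^{\mathbf{w}}$ form a basis of $\mathbb{R}^3$); it satisfies $\Psi_{\mathbf{w}}^X(\tilde{\mathbf{g}}_M^{\mathbf{w}Y})=\tilde{\mathbf{g}}_M^{\mathbf{w}XY}$ for all $Y\in\mathcal{M}$. $\Psi_{i,1}\in\mathrm{GL}(\mathbb{R}^3)$ is the linear map with $\tilde{\mathbf{e}}_{k_0}\mapsto\tilde{\mathbf{e}}_{s_0}$, $\tilde{\mathbf{e}}_{s_0}\mapsto-\tilde{\mathbf{e}}_{k_0}+2\tilde{\mathbf{e}}_{s_0}$, $\tilde{\mathbf{e}}_{t_0}\mapsto\tilde{\mathbf{e}}_{t_0}$. *)

theory Defs
  imports "HOL-Analysis.Analysis"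
begin

text \<open>
  The index set \<open>{1,2,3}\<close> is the three-element numeral type \<^typ>\<open>3\<close>, whose elements are
  exactly \<open>1\<close>, \<open>2\<close> and \<open>3\<close> (with \<open>3 = 0\<close>).  Matrices have type \<^typ>\<open>real^3^3\<close> and
  \<open>A $ i $ j\<close> is the entry in row \<open>i\<close> and column \<open>j\<close>.
\<close>

definition b_mat :: "real \<Rightarrow> real \<Rightarrow> real \<Rightarrow> real \<Rightarrow> real \<Rightarrow> real \<Rightarrow> real^3^3" where
  "b_mat p p' q q' r r' =
     vector [vector [0, - p', r],
             vector [p, 0, - q'],
             vector [- r', q, 0]]"

definition diag_mat :: "real^3 \<Rightarrow> real^3^3" where
  "diag_mat d = (\<chi> i j. if i = j then d $ i else 0)"

text \<open>A sequence \<open>[k\<^sub>1, \<dots>, k\<^sub>n]\<close> is a list, and \<open>w[k]\<close> is \<open>w @ [k]\<close>.\<close>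

definition reduced :: "3 list \<Rightarrow> bool" where
  "reduced w \<longleftrightarrow> (\<forall>j. Suc j < length w \<longrightarrow> w ! j \<noteq> w ! Suc j)"

definition T_ge :: "3 \<Rightarrow> 3 list set" where
  "T_ge i = {w. reduced w \<and> w \<noteq> [] \<and> hd w = i}"

definition B_at :: "real^3^3 \<Rightarrow> 3 list \<Rightarrow> real^3^3" where
  "B_at B w = (-1) ^ length w *\<^sub>R B"

text \<open>
  The recursions for \<open>C\<close> and \<open>G\<close> extend a sequence at its end, so they are first written by
  primitive recursion on the reversed sequence; the lemmas below restate them for \<open>w @ [k]\<close>.
\<close>

primrec C_rev :: "real^3^3 \<Rightarrow> 3 list \<Rightarrow> real^3^3" where
  "C_rev B [] = mat 1"
| "C_rev B (k # v) =
     (let C = C_rev B v; b = B_at B (rev v) in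
      \<chi> i j. if j = k then - C $ i $ k
             else C $ i $ j + C $ i $ k * max (b $ k $ j) 0 + max (- C $ i $ k) 0 * b $ k $ j)"

primrec G_rev :: "real^3^3 \<Rightarrow> 3 list \<Rightarrow> real^3^3" where
  "G_rev B [] = mat 1"
| "G_rev B (k # v) =
     (let C = C_rev B v; G = G_rev B v; b = B_at B (rev v) in
      \<chi> i j. if j \<noteq> k then G $ i $ j
             else - G $ i $ k + (\<Sum>l\<in>UNIV. G $ i $ l * max (- b $ l $ k) 0)
                  - (\<Sum>l\<in>UNIV. B_at B [] $ i $ l * max (- C $ l $ k) 0))"

definition C_mat :: "real^3^3 \<Rightarrow> 3 list \<Rightarrow> real^3^3" where
  "C_mat B w = C_rev B (rev w)"

definition G_mat :: "real^3^3 \<Rightarrow> 3 list \<Rightarrow> real^3^3" where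
  "G_mat B w = G_rev B (rev w)"

lemma C_mat_Nil: "C_mat B [] = mat 1"
  by (simp add: C_mat_def)

lemma C_mat_snoc:
  "C_mat B (w @ [k]) $ i $ j =
     (if j = k then - C_mat B w $ i $ k
      else C_mat B w $ i $ j + C_mat B w $ i $ k * max (B_at B w $ k $ j) 0
           + max (- C_mat B w $ i $ k) 0 * B_at B w $ k $ j)"
  by (simp add: C_mat_def Let_def)

lemma G_mat_Nil: "G_mat B [] = mat 1"
  by (simp add: G_mat_def)

lemma G_mat_snoc:
  "G_mat B (w @ [k]) $ i $ j =
     (if j \<noteq> k then G_mat B w $ i $ j
      else - G_mat B w $ i $ k + (\<Sum>l\<in>UNIV. G_mat B w $ i $ l * max (- B_at B w $ l $ k) 0)
           - (\<Sum>l\<in>UNIV. B_at B [] $ i $ l * max (- C_mat B w $ l $ k) 0))"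
  by (simp add: G_mat_def C_mat_def Let_def)

definition c_vec :: "real^3^3 \<Rightarrow> 3 list \<Rightarrow> 3 \<Rightarrow> real^3" where
  "c_vec B w j = column j (C_mat B w)"

definition g_vec :: "real^3^3 \<Rightarrow> 3 list \<Rightarrow> 3 \<Rightarrow> real^3" where
  "g_vec B w j = column j (G_mat B w)"

definition g_mod :: "real^3^3 \<Rightarrow> real^3 \<Rightarrow> 3 list \<Rightarrow> 3 \<Rightarrow> real^3" where
  "g_mod B d w j = (d $ j) powr (- 1 / 2) *\<^sub>R g_vec B w j"

definition e_mod :: "real^3 \<Rightarrow> 3 \<Rightarrow> real^3" where
  "e_mod d j = (d $ j) powr (- 1 / 2) *\<^sub>R axis j 1"

text \<open>The value \<open>0\<close> is a junk value for vectors that are zero or not sign-coherent.\<close>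

definition c_sign :: "real^3^3 \<Rightarrow> 3 list \<Rightarrow> 3 \<Rightarrow> real" where
  "c_sign B w j =
     (if c_vec B w j \<noteq> 0 \<and> (\<forall>i. 0 \<le> c_vec B w j $ i) then 1
      else if c_vec B w j \<noteq> 0 \<and> (\<forall>i. c_vec B w j $ i \<le> 0) then - 1
      else 0)"

definition K_ind :: "3 list \<Rightarrow> 3" where
  "K_ind w = last w"

definition S_ind :: "real^3^3 \<Rightarrow> 3 list \<Rightarrow> 3" where
  "S_ind B w =
     (THE s. s \<noteq> K_ind w \<and> c_sign B w s \<noteq> c_sign B w (K_ind w)
             \<and> c_sign B w s * B_at B w $ K_ind w $ s < 0)"

definition T_ind :: "real^3^3 \<Rightarrow> 3 list \<Rightarrow> 3" where
  "T_ind B w = (THE t. t \<noteq> K_ind w \<and> t \<noteq> S_ind B w)"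

text \<open>
  Elements of the free monoid on \<open>S\<close> and \<open>T\<close> are lists of letters; as the action is a right
  action, the first letter of the list acts first.
\<close>

datatype letter = LetS | LetT

fun act1 :: "real^3^3 \<Rightarrow> 3 list \<Rightarrow> letter \<Rightarrow> 3 list" where
  "act1 B w LetS = w @ [S_ind B w]"
| "act1 B w LetT = w @ [T_ind B w]"

definition act :: "real^3^3 \<Rightarrow> 3 list \<Rightarrow> letter list \<Rightarrow> 3 list" where
  "act B w X = foldl (act1 B) w X"

definition open_cone :: "(real^3) list \<Rightarrow> (real^3) set" where
  "open_cone vs =
     {(\<Sum>j<length vs. lam j *\<^sub>R vs ! j) | lam :: nat \<Rightarrow> real. \<forall>j<length vs. 0 < lam j}"

definition g_frak :: "real^3^3 \<Rightarrow> real^3 \<Rightarrow> 3 \<Rightarrow> real^3" where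
  "g_frak B d i = e_mod d (S_ind B [i]) + e_mod d (T_ind B [i]) - e_mod d (K_ind [i])"

definition phi :: "real^3^3 \<Rightarrow> real^3 \<Rightarrow> 3 list \<Rightarrow> (real^3) set" where
  "phi B d w =
     open_cone [g_mod B d w (K_ind w), g_mod B d w (K_ind w) - g_frak B d (hd w)]"

definition F_cone :: "real^3^3 \<Rightarrow> real^3 \<Rightarrow> 3 \<Rightarrow> (real^3) set" where
  "F_cone B d i =
     open_cone [e_mod d (S_ind B [i]), e_mod d (K_ind [i]) - e_mod d (T_ind B [i])]"

definition Psi :: "real^3^3 \<Rightarrow> real^3 \<Rightarrow> 3 list \<Rightarrow> letter list \<Rightarrow> real^3 \<Rightarrow> real^3" where
  "Psi B d w X =
     (THE f. linear f
        \<and> f (g_mod B d w (K_ind w)) = g_mod B d (act B w X) (K_ind (act B w X))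
        \<and> f (g_mod B d w (S_ind B w)) = g_mod B d (act B w X) (S_ind B (act B w X))
        \<and> f (g_mod B d w (T_ind B w)) = g_mod B d (act B w X) (T_ind B (act B w X)))"

definition Psi1 :: "real^3^3 \<Rightarrow> real^3 \<Rightarrow> 3 \<Rightarrow> real^3 \<Rightarrow> real^3" where
  "Psi1 B d i =
     (THE f. linear f
        \<and> f (e_mod d (K_ind [i])) = e_mod d (S_ind B [i])
        \<and> f (e_mod d (S_ind B [i])) = - e_mod d (K_ind [i]) + 2 *\<^sub>R e_mod d (S_ind B [i])
        \<and> f (e_mod d (T_ind B [i])) = e_mod d (T_ind B [i]))"

end

theory Submission
  imports Defs
begin

text \<open>
  After rescaling by \<open>d\<^sub>j powr (- 1/2)\<close> the matrix \<open>B\<close> has off-diagonal entries \<open>\<plusminus>2\<close>, arranged as an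
  oriented 3-cycle, and every mutation merely reverses the cycle.  A rescaled mutation at \<open>j\<close>
  therefore moves only two \<open>c\<close>-vectors and one \<open>g\<close>-vector: with \<open>l\<close> the neighbour of \<open>j\<close> selected
  by the sign of \<open>c\<^sub>j\<close>, it sends \<open>c\<^sub>j\<close> to \<open>- c\<^sub>j\<close>, \<open>c\<^sub>l\<close> to \<open>c\<^sub>l + 2 c\<^sub>j\<close> and \<open>g\<^sub>j\<close> to
  \<open>2 g\<^sub>l - g\<^sub>j\<close> (\<open>mutation_c\<close>, \<open>mutation_g\<close>).  Following the three signs and the
  orientation of the cycle through these moves determines \<open>K\<close>, \<open>S\<close>, \<open>T\<close> at every word
  (\<open>position_S\<close>, \<open>position_T_trunk\<close>, \<open>position_T_branch\<close>); the positivity needed to know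
  the sign of \<open>c\<^sub>l + 2 c\<^sub>j\<close> is carried along as \<open>c\<^sub>K + c\<^sub>S\<close> lying in the
  closed orthant that contains \<open>c\<^sub>S\<close>.

  The upshot is a linear recursion for the frame \<open>(g\<^sub>K, g\<^sub>S, g\<^sub>T)\<close>.  The letter \<open>S\<close> sends \<open>(a, b, c)\<close>
  to \<open>(2a - b, a, c)\<close>; the letter \<open>T\<close> sends it to \<open>(2b - c, b, a)\<close> on the trunk, that is as long
  as no \<open>T\<close> has occurred, and to \<open>(2a - c, a, b)\<close> in a branch (\<open>phase_step\<close>).  Two consequences
  give the theorem.

  The recursion commutes with linear maps, so a linear map matching the frames of two words in
  the same phase matches the frames of all their continuations.  Hence \<open>\<Psi>\<^sub>i\<^sub>,\<^sub>1\<close> inserts an \<open>S\<close> after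
  the initial letter, and \<open>\<Psi>\<close> at a branch word \<open>w\<close> inserts letters directly after \<open>w\<close>
  (\<open>Psi1_frame\<close>, \<open>Psi_frame\<close>).

  The vector \<open>g\<^sub>K + g\<^sub>T - g\<^sub>S\<close> on the trunk and \<open>g\<^sub>S + g\<^sub>T - g\<^sub>K\<close> in a branch is
  conserved by the recursion, and its value is the vector \<open>\<gg>\<^sub>i\<close> that defines the cones
  (\<open>g_frak_invariant\<close>).  So all these linear maps fix \<open>\<gg>\<^sub>i\<close> and carry the cone of one word to the cone
  of another.  As \<open>F\<^sub>i\<close> is the cone over \<open>e\<^sub>S\<close> and \<open>e\<^sub>S - \<gg>\<^sub>i\<close>, of the same shape, it takes the place of
  a cone one step before \<open>[i]\<close>.
\<close>

section \<open>Rescaled mutation data\<close>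

definition weight :: "real^3 \<Rightarrow> 3 \<Rightarrow> real" where
  "weight d j = d $ j powr (- 1 / 2)"

definition c_mod :: "real^3^3 \<Rightarrow> real^3 \<Rightarrow> 3 list \<Rightarrow> 3 \<Rightarrow> real^3" where
  "c_mod B d w j = weight d j *\<^sub>R c_vec B w j"

text \<open>
  The rescaled matrix is the 3-cycle through \<open>k, s, t\<close> with entry \<open>- 2 \<eta>\<close> along it and \<open>2 \<eta>\<close>
  against it.  A sign together with an ordered triple, instead of a fixed labelling by \<open>1, 2, 3\<close>,
  lets every mutation rule be stated once for all labellings.
\<close>

definition cyclic_of_sign :: "real^3 \<Rightarrow> real^3^3 \<Rightarrow> real \<Rightarrow> 3 \<Rightarrow> 3 \<Rightarrow> 3 \<Rightarrow> bool" where
  "cyclic_of_sign d b \<eta> k s t \<longleftrightarrow>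
     k \<noteq> s \<and> s \<noteq> t \<and> t \<noteq> k \<and> (\<eta> = 1 \<or> \<eta> = - 1) \<and> (\<forall>j. b $ j $ j = 0)
     \<and> b $ k $ s = - 2 * \<eta> * weight d k / weight d s \<and> b $ s $ k = 2 * \<eta> * weight d s / weight d k
     \<and> b $ s $ t = - 2 * \<eta> * weight d s / weight d t \<and> b $ t $ s = 2 * \<eta> * weight d t / weight d s
     \<and> b $ t $ k = - 2 * \<eta> * weight d t / weight d k \<and> b $ k $ t = 2 * \<eta> * weight d k / weight d t"

lemma cyclic_of_sign_rotate:
  "cyclic_of_sign d b \<eta> k s t \<Longrightarrow> cyclic_of_sign d b \<eta> s t k"
  by (auto simp: cyclic_of_sign_def)

lemma cyclic_of_sign_swap:
  "cyclic_of_sign d b \<eta> k s t \<Longrightarrow> cyclic_of_sign d b (- \<eta>) s k t"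
  by (auto simp: cyclic_of_sign_def)

lemma cyclic_of_sign_uminus:
  "cyclic_of_sign d b \<eta> k s t \<Longrightarrow> cyclic_of_sign d (- b) (- \<eta>) k s t"
  by (auto simp: cyclic_of_sign_def)

lemma UNIV_3_distinct:
  fixes k s t :: 3
  assumes "k \<noteq> s" "s \<noteq> t" "t \<noteq> k"
  shows "UNIV = {k, s, t}"
  using assms exhaust_3[of k] exhaust_3[of s] exhaust_3[of t] by (auto simp: UNIV_3)

lemma sum_3_distinct:
  fixes k s t :: 3 and f :: "3 \<Rightarrow> 'a::comm_monoid_add"
  assumes "k \<noteq> s" "s \<noteq> t" "t \<noteq> k"
  shows "sum f UNIV = f k + f s + f t"
  using assms by (simp add: UNIV_3_distinct[OF assms] add.assoc)

definition has_sign :: "real \<Rightarrow> real^3 \<Rightarrow> bool" where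
  "has_sign \<epsilon> v \<longleftrightarrow> v \<noteq> 0 \<and> (\<forall>i. 0 \<le> \<epsilon> * v $ i)"

lemma has_sign_uminus: "has_sign \<epsilon> v \<Longrightarrow> has_sign (- \<epsilon>) (- v)"
  by (simp add: has_sign_def)

text \<open>
  Vectors of one sign cannot cancel.
\<close>

lemma has_sign_add:
  assumes "has_sign \<epsilon> v" "\<And>i. 0 \<le> \<epsilon> * u $ i" "\<epsilon> = 1 \<or> \<epsilon> = - 1"
  shows "has_sign \<epsilon> (u + v)"
proof -
  have "u + v \<noteq> 0"
  proof
    assume z: "u + v = 0"
    have "v $ i = 0" for i
    proof -
      have "u $ i + v $ i = 0" using z by (metis vector_add_component zero_index)
      moreover have "0 \<le> \<epsilon> * v $ i" "0 \<le> \<epsilon> * u $ i" using assms by (auto simp: has_sign_def)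
      ultimately show ?thesis using assms(3) by auto
    qed
    then show False using assms(1) by (auto simp: has_sign_def vec_eq_iff)
  qed
  moreover have "0 \<le> \<epsilon> * (u + v) $ i" for i
    using assms(1) assms(2)[of i] by (simp add: has_sign_def distrib_left)
  ultimately show ?thesis by (simp add: has_sign_def)
qed

text \<open>
  For a word \<open>w\<close> whose matrix is the cycle \<open>k, s, t\<close> of sign \<open>\<eta>\<close>, this is the duality
  \<open>G\<^sup>w B\<^sup>w = B C\<^sup>w\<close> written out columnwise and rescaled.  It is what turns the \<open>B\<close>-term of the
  \<open>g\<close>-vector recursion into \<open>g\<close>-vectors when the \<open>c\<close>-vector is negative.
\<close>

definition dual_relations :: "real^3^3 \<Rightarrow> real^3 \<Rightarrow> 3 list \<Rightarrow> real \<Rightarrow> 3 \<Rightarrow> 3 \<Rightarrow> 3 \<Rightarrow> bool" where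
  "dual_relations B d w \<eta> k s t \<longleftrightarrow>
     B *v c_mod B d w k = (2 * \<eta>) *\<^sub>R (g_mod B d w s - g_mod B d w t)
   \<and> B *v c_mod B d w s = (2 * \<eta>) *\<^sub>R (g_mod B d w t - g_mod B d w k)
   \<and> B *v c_mod B d w t = (2 * \<eta>) *\<^sub>R (g_mod B d w k - g_mod B d w s)"

lemma dual_relations_rotate: "dual_relations B d w \<eta> k s t \<Longrightarrow> dual_relations B d w \<eta> s t k"
  by (simp add: dual_relations_def)

lemma dual_relations_swap: "dual_relations B d w \<eta> k s t \<Longrightarrow> dual_relations B d w (- \<eta>) s k t"
  by (simp add: dual_relations_def scaleR_diff_right)

lemma B_at_Nil: "B_at B [] = B"
  by (simp add: B_at_def)

lemma B_at_snoc: "B_at B (w @ [k]) = - B_at B w"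
  by (simp add: B_at_def)

section \<open>Frames and their linear recursion\<close>

definition frame :: "real^3^3 \<Rightarrow> real^3 \<Rightarrow> 3 list \<Rightarrow> (real^3) \<times> (real^3) \<times> (real^3)" where
  "frame B d w = (g_mod B d w (K_ind w), g_mod B d w (S_ind B w), g_mod B d w (T_ind B w))"

text \<open>
  The truth value tells whether the word before the step lies in a branch.
\<close>

fun next_frame :: "bool \<Rightarrow> letter \<Rightarrow> (real^3) \<times> (real^3) \<times> (real^3) \<Rightarrow> (real^3) \<times> (real^3) \<times> (real^3)" where
  "next_frame br LetS (a, b, c) = (2 *\<^sub>R a - b, a, c)"
| "next_frame False LetT (a, b, c) = (2 *\<^sub>R b - c, b, a)"
| "next_frame True LetT (a, b, c) = (2 *\<^sub>R a - c, a, b)"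

text \<open>
  The conserved vector of the recursion.  The negative coefficient moves from the second slot to
  the first when the first letter \<open>T\<close> occurs; together with the recursion on the trunk,
  \<open>(a, b, c) \<mapsto> (2b - c, b, a)\<close>, this keeps the value \<open>a + c - b\<close>.
\<close>

fun frame_invariant :: "bool \<Rightarrow> (real^3) \<times> (real^3) \<times> (real^3) \<Rightarrow> real^3" where
  "frame_invariant False (a, b, c) = a + c - b"
| "frame_invariant True (a, b, c) = b + c - a"

lemma frame_invariant_next:
  "frame_invariant (br \<or> M = LetT) (next_frame br M F) = frame_invariant br F"
  by (cases F; cases br; cases M) (auto simp: scaleR_2)

text \<open>
  The three vectors form a basis, expressed by its universal property: this is the form that the
  definite descriptions defining \<open>\<Psi>\<close> ask for, and it passes through \<open>next_frame\<close> by rewriting the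
  conditions on \<open>f\<close>.
\<close>

definition determining :: "(real^3) \<times> (real^3) \<times> (real^3) \<Rightarrow> bool" where
  "determining F \<longleftrightarrow> (case F of (a, b, c) \<Rightarrow>
     \<forall>x y z :: real^3. \<exists>!f. linear f \<and> f a = x \<and> f b = y \<and> f c = z)"

lemma determining_next:
  assumes "determining F"
  shows "determining (next_frame br M F)"
proof -
  obtain a b c where F: "F = (a, b, c)" by (metis prod_cases3)
  have ex: "\<exists>!f. linear f \<and> f a = x \<and> f b = y \<and> f c = z" for x y z :: "real^3"
    using assms by (simp add: determining_def F)
  have S: "(linear (f :: real^3 \<Rightarrow> real^3) \<and> f (2 *\<^sub>R a - b) = x \<and> f a = y \<and> f c = z) \<longleftrightarrow>
     (linear f \<and> f a = y \<and> f b = 2 *\<^sub>R y - x \<and> f c = z)" for f x y z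
    by (auto simp: linear_diff linear_scale)
  have T: "(linear (f :: real^3 \<Rightarrow> real^3) \<and> f (2 *\<^sub>R b - c) = x \<and> f b = y \<and> f a = z) \<longleftrightarrow>
     (linear f \<and> f a = z \<and> f b = y \<and> f c = 2 *\<^sub>R y - x)" for f x y z
    by (auto simp: linear_diff linear_scale)
  have T': "(linear (f :: real^3 \<Rightarrow> real^3) \<and> f (2 *\<^sub>R a - c) = x \<and> f a = y \<and> f b = z) \<longleftrightarrow>
     (linear f \<and> f a = y \<and> f b = z \<and> f c = 2 *\<^sub>R y - x)" for f x y z
    by (auto simp: linear_diff linear_scale)
  show ?thesis
    unfolding F by (cases br; cases M) (auto simp only: determining_def next_frame.simps prod.case S T T' intro!: ex)
qed

definition map_frame :: "(real^3 \<Rightarrow> real^3) \<Rightarrow> (real^3) \<times> (real^3) \<times> (real^3) \<Rightarrow> (real^3) \<times> (real^3) \<times> (real^3)" where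
  "map_frame f F = map_prod f (map_prod f f) F"

text \<open>
  The recursion takes fixed linear combinations of the frame vectors, so it is natural in linear
  maps.
\<close>

lemma map_frame_next:
  "linear f \<Longrightarrow> map_frame f (next_frame br M F) = next_frame br M (map_frame f F)"
  by (cases F; cases br; cases M) (auto simp: map_frame_def linear_diff linear_scale)

lemma map_frame_invariant:
  "linear f \<Longrightarrow> f (frame_invariant br F) = frame_invariant br (map_frame f F)"
  by (cases F; cases br) (auto simp: map_frame_def linear_diff linear_add)

lemma determining_e_mod:
  fixes k s t :: 3
  assumes d: "\<And>j. d $ j > 0" and dist: "k \<noteq> s" "s \<noteq> t" "t \<noteq> k"
  shows "determining (e_mod d k, e_mod d s, e_mod d t)"
proof -
  have w: "weight d j > 0" for j using d[of j] by (simp add: weight_def)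
  have e: "e_mod d j = weight d j *\<^sub>R axis j 1" for j by (simp add: e_mod_def weight_def)
  have "\<exists>!f. linear f \<and> f (e_mod d k) = x \<and> f (e_mod d s) = y \<and> f (e_mod d t) = z"
    for x y z :: "real^3"
  proof (rule ex_ex1I)
    (* Expand a vector in the rescaled unit vectors and send these to x, y, z. *)
    let ?f = "\<lambda>v::real^3. (v $ k / weight d k) *\<^sub>R x + (v $ s / weight d s) *\<^sub>R y + (v $ t / weight d t) *\<^sub>R z"
    have "linear ?f"
      by (rule linearI) (simp_all add: algebra_simps add_divide_distrib)
    moreover have "?f (e_mod d k) = x" "?f (e_mod d s) = y" "?f (e_mod d t) = z"
      using dist w[of k] w[of s] w[of t] by (auto simp: e axis_def)
    ultimately show "\<exists>f. linear f \<and> f (e_mod d k) = x \<and> f (e_mod d s) = y \<and> f (e_mod d t) = z"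
      by blast
  next
    fix f g :: "real^3 \<Rightarrow> real^3"
    assume f: "linear f \<and> f (e_mod d k) = x \<and> f (e_mod d s) = y \<and> f (e_mod d t) = z"
      and g: "linear g \<and> g (e_mod d k) = x \<and> g (e_mod d s) = y \<and> g (e_mod d t) = z"
    have "f (e_mod d j) = g (e_mod d j)" for j
      using f g UNIV_3_distinct[OF dist] by (metis UNIV_I insertE singletonD)
    then have scaled: "weight d j *\<^sub>R f (axis j 1) = weight d j *\<^sub>R g (axis j 1)" for j
      using f g by (metis e linear_scale)
    have "f (axis j 1) = g (axis j 1)" for j
      using scaled[of j] w[of j] by simp
    then show "f = g"
      using f g by (auto intro!: linear_eq_stdbasis simp: Basis_vec_def)
  qed
  then show ?thesis by (simp add: determining_def)
qed

lemma linear_image_open_cone: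
  assumes "linear f"
  shows "f ` open_cone vs = open_cone (map f vs)"
proof -
  have "f (\<Sum>j<length vs. lam j *\<^sub>R vs ! j) = (\<Sum>j<length (map f vs). lam j *\<^sub>R map f vs ! j)" for lam
    using assms by (simp add: linear_sum linear_scale)
  then have "f ` {\<Sum>j<length vs. lam j *\<^sub>R vs ! j | lam. \<forall>j<length vs. 0 < lam j}
      = {\<Sum>j<length (map f vs). lam j *\<^sub>R map f vs ! j | lam. \<forall>j<length (map f vs). 0 < lam j}"
    by (simp only: setcompr_eq_image image_image length_map)
  then show ?thesis by (simp only: open_cone_def)
qed

section \<open>Mutation of signed vectors\<close>

locale markov_type =
  fixes B :: "real^3^3" and d :: "real^3"
  assumes d_pos: "\<And>j. d $ j > 0"
    and B_cyclic: "\<exists>\<eta>. cyclic_of_sign d B \<eta> 1 2 3"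
begin

lemma weight_pos: "weight d j > 0"
  using d_pos[of j] by (simp add: weight_def)

text \<open>
  The rescaling has positive factors, so it does not change signs.
\<close>

lemma c_sign_eq:
  assumes "has_sign \<epsilon> (c_mod B d w j)" "\<epsilon> = 1 \<or> \<epsilon> = - 1"
  shows "c_sign B w j = \<epsilon>"
proof -
  have nz: "c_vec B w j \<noteq> 0" using assms by (auto simp: has_sign_def c_mod_def)
  have s: "0 \<le> \<epsilon> * c_vec B w j $ i" for i
  proof -
    have "0 \<le> weight d j * (\<epsilon> * c_vec B w j $ i)"
      using assms(1) by (simp add: has_sign_def c_mod_def mult.left_commute)
    then show ?thesis using weight_pos[of j] by (simp add: zero_le_mult_iff)
  qed
  from nz obtain i where i: "c_vec B w j $ i \<noteq> 0" by (auto simp: vec_eq_iff)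
  from assms(2) show ?thesis
  proof
    assume "\<epsilon> = 1"
    then show ?thesis using nz s by (simp add: c_sign_def)
  next
    assume "\<epsilon> = - 1"
    then show ?thesis using nz s i by (auto simp: c_sign_def dest!: antisym)
  qed
qed

text \<open>
  Once the sign \<open>\<epsilon>\<close> of \<open>c\<^sub>j\<close> is known, the recursion adds \<open>max (\<epsilon> b\<^sub>j\<^sub>x) 0\<close> times \<open>c\<^sub>j\<close> to
  \<open>c\<^sub>x\<close>, and of the two entries \<open>\<epsilon> b\<^sub>j\<^sub>x\<close> in row \<open>j\<close> of a cycle exactly one is positive.
\<close>

lemma mutation_c:
  assumes cyc: "cyclic_of_sign d (B_at B w) \<epsilon> l j m" and sgn: "has_sign \<epsilon> (c_mod B d w j)"
  shows "c_mod B d (w @ [j]) j = - c_mod B d w j"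
    and "c_mod B d (w @ [j]) l = c_mod B d w l + 2 *\<^sub>R c_mod B d w j"
    and "c_mod B d (w @ [j]) m = c_mod B d w m"
proof -
  have W: "weight d l > 0" "weight d j > 0" "weight d m > 0" by (rule weight_pos)+
  have e: "\<epsilon> = 1 \<or> \<epsilon> = - 1" using cyc by (simp add: cyclic_of_sign_def)
  have s: "0 \<le> \<epsilon> * C_mat B w $ i $ j" for i
  proof -
    have "0 \<le> weight d j * (\<epsilon> * C_mat B w $ i $ j)"
      using sgn by (simp add: has_sign_def c_mod_def c_vec_def column_def mult.left_commute)
    then show ?thesis using W by (simp add: zero_le_mult_iff)
  qed
  have b: "B_at B w $ j $ l = 2 * \<epsilon> * weight d j / weight d l"
     "B_at B w $ j $ m = - 2 * \<epsilon> * weight d j / weight d m"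
    and ne: "l \<noteq> j" "m \<noteq> j" using cyc by (auto simp: cyclic_of_sign_def)
  have mx: "max (- C_mat B w $ i $ j) 0 = (if \<epsilon> = 1 then 0 else - C_mat B w $ i $ j)" for i
    using s[of i] e by auto
  show "c_mod B d (w @ [j]) j = - c_mod B d w j"
    by (simp add: vec_eq_iff c_mod_def c_vec_def column_def C_mat_snoc)
  show "c_mod B d (w @ [j]) l = c_mod B d w l + 2 *\<^sub>R c_mod B d w j"
    using e W ne
    by (auto simp: vec_eq_iff c_mod_def c_vec_def column_def C_mat_snoc b mx field_simps)
  show "c_mod B d (w @ [j]) m = c_mod B d w m"
    using e W ne
    by (auto simp: vec_eq_iff c_mod_def c_vec_def column_def C_mat_snoc b mx field_simps)
qed

text \<open>
  For positive \<open>c\<^sub>j\<close> the \<open>B\<close>-term vanishes and \<open>l\<close> is the only index with \<open>b\<^sub>l\<^sub>j < 0\<close>.  For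
  negative \<open>c\<^sub>j\<close> the first sum contributes \<open>g\<^sub>m\<close> instead, and by duality the \<open>B\<close>-term replaces it
  by \<open>g\<^sub>l\<close>; the two cases thus have the same outcome.
\<close>

lemma mutation_g:
  assumes cyc: "cyclic_of_sign d (B_at B w) \<epsilon> l j m" and sgn: "has_sign \<epsilon> (c_mod B d w j)"
    and dual: "dual_relations B d w \<epsilon> l j m"
  shows "g_mod B d (w @ [j]) j = 2 *\<^sub>R g_mod B d w l - g_mod B d w j"
    and "g_mod B d (w @ [j]) l = g_mod B d w l"
    and "g_mod B d (w @ [j]) m = g_mod B d w m"
proof -
  have W: "weight d l > 0" "weight d j > 0" "weight d m > 0" by (rule weight_pos)+
  have e: "\<epsilon> = 1 \<or> \<epsilon> = - 1" using cyc by (simp add: cyclic_of_sign_def)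
  have gm: "g_mod B d v x $ i = weight d x * G_mat B v $ i $ x" for v x i
    by (simp add: g_mod_def g_vec_def column_def weight_def)
  have s: "0 \<le> \<epsilon> * C_mat B w $ i $ j" for i
  proof -
    have "0 \<le> weight d j * (\<epsilon> * C_mat B w $ i $ j)"
      using sgn by (simp add: has_sign_def c_mod_def c_vec_def column_def mult.left_commute)
    then show ?thesis using W by (simp add: zero_le_mult_iff)
  qed
  have b: "B_at B w $ l $ j = - 2 * \<epsilon> * weight d l / weight d j"
     "B_at B w $ m $ j = 2 * \<epsilon> * weight d m / weight d j" "B_at B w $ j $ j = 0"
    and ne: "l \<noteq> j" "j \<noteq> m" "m \<noteq> l" using cyc by (auto simp: cyclic_of_sign_def)
  show "g_mod B d (w @ [j]) l = g_mod B d w l" "g_mod B d (w @ [j]) m = g_mod B d w m"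
    using ne by (auto simp: vec_eq_iff gm G_mat_snoc)
  have sums: "(\<Sum>x\<in>UNIV. G_mat B w $ i $ x * max (- B_at B w $ x $ j) 0)
      = G_mat B w $ i $ l * max (2 * \<epsilon> * weight d l / weight d j) 0
        + G_mat B w $ i $ m * max (- 2 * \<epsilon> * weight d m / weight d j) 0" for i
    by (simp add: sum_3_distinct[OF ne] b)
  from e show "g_mod B d (w @ [j]) j = 2 *\<^sub>R g_mod B d w l - g_mod B d w j"
  proof
    assume [simp]: "\<epsilon> = 1"
    have "max (- C_mat B w $ x $ j) 0 = 0" for x using s[of x] by simp
    then show ?thesis using W
      by (auto simp: vec_eq_iff gm G_mat_snoc sums field_simps)
  next
    assume [simp]: "\<epsilon> = - 1"
    have mx: "max (- C_mat B w $ x $ j) 0 = - C_mat B w $ x $ j" for x using s[of x] by simp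
    have du: "weight d j * (\<Sum>x\<in>UNIV. B $ i $ x * C_mat B w $ x $ j)
        = 2 * (g_mod B d w l $ i - g_mod B d w m $ i)" for i
    proof -
      have "(B *v c_mod B d w j) $ i = 2 * (g_mod B d w l $ i - g_mod B d w m $ i)"
        using dual by (simp add: dual_relations_def)
      then show ?thesis
        by (simp add: matrix_vector_mult_def c_mod_def c_vec_def column_def sum_distrib_left mult.left_commute)
    qed
    have eq: "G_mat B (w @ [j]) $ i $ j = - G_mat B w $ i $ j
        + G_mat B w $ i $ m * (2 * weight d m / weight d j)
        + (\<Sum>x\<in>UNIV. B $ i $ x * C_mat B w $ x $ j)" for i
      using W by (simp add: G_mat_snoc sums mx B_at_Nil sum_negf)
    show ?thesis
      unfolding vec_eq_iff
    proof
      fix i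
      have "g_mod B d (w @ [j]) j $ i = - weight d j * G_mat B w $ i $ j
        + 2 * weight d m * G_mat B w $ i $ m
        + weight d j * (\<Sum>x\<in>UNIV. B $ i $ x * C_mat B w $ x $ j)"
        unfolding gm eq using W(2) by (simp add: distrib_left right_diff_distrib)
      then show "g_mod B d (w @ [j]) j $ i = (2 *\<^sub>R g_mod B d w l - g_mod B d w j) $ i"
        unfolding du by (simp add: gm)
    qed
  qed
qed

lemma mutation_dual:
  assumes cyc: "cyclic_of_sign d (B_at B w) \<epsilon> l j m" and sgn: "has_sign \<epsilon> (c_mod B d w j)"
    and dual: "dual_relations B d w \<epsilon> l j m"
  shows "dual_relations B d (w @ [j]) (- \<epsilon>) l j m"
proof -
  have "B *v (- v) = - (B *v v)" for v
    using matrix_vector_mult_scaleR[of B "- 1" v] by simp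
  then show ?thesis
    using dual unfolding dual_relations_def mutation_c[OF cyc sgn] mutation_g[OF assms]
    by (simp add: matrix_vector_right_distrib matrix_vector_mult_scaleR)
      (simp add: vec_eq_iff algebra_simps)
qed

section \<open>The indices K, S, T along a word\<close>

text \<open>
  The signs of \<open>c\<^sub>K\<close> and \<open>c\<^sub>S\<close> always differ; whether \<open>c\<^sub>T\<close> sides with \<open>c\<^sub>K\<close> is what separates
  the words in a branch from the others.  The last clause
  guarantees that \<open>c\<^sub>K + 2 c\<^sub>S\<close>, which a step \<open>S\<close> produces, has the sign of \<open>c\<^sub>S\<close>.
\<close>

definition position :: "bool \<Rightarrow> 3 list \<Rightarrow> real \<Rightarrow> 3 \<Rightarrow> 3 \<Rightarrow> 3 \<Rightarrow> bool" where
  "position br w \<eta> k s t \<longleftrightarrow>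
     w \<noteq> [] \<and> last w = k \<and> cyclic_of_sign d (B_at B w) \<eta> k s t \<and> dual_relations B d w \<eta> k s t
     \<and> has_sign (- \<eta>) (c_mod B d w k) \<and> has_sign \<eta> (c_mod B d w s)
     \<and> has_sign (if br then - \<eta> else \<eta>) (c_mod B d w t)
     \<and> (\<forall>i. 0 \<le> \<eta> * (c_mod B d w k + c_mod B d w s) $ i)"

text \<open>
  The index \<open>t\<close> cannot be taken for \<open>S\<close>: outside a branch the entry
  \<open>b\<^sub>k\<^sub>t\<close> has the wrong sign for it, and in a branch \<open>c\<^sub>t\<close> has the sign of \<open>c\<^sub>k\<close>.
\<close>

lemma position_indices:
  assumes "position br w \<eta> k s t"
  shows "K_ind w = k" "S_ind B w = s" "T_ind B w = t"
proof -
  have cyc: "cyclic_of_sign d (B_at B w) \<eta> k s t" using assms by (simp add: position_def)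
  then have e: "\<eta> = 1 \<or> \<eta> = - 1" and ne: "k \<noteq> s" "s \<noteq> t" "t \<noteq> k"
    by (auto simp: cyclic_of_sign_def)
  show K: "K_ind w = k" using assms by (simp add: position_def K_ind_def)
  have sk: "c_sign B w k = - \<eta>" "c_sign B w s = \<eta>" "c_sign B w t = (if br then - \<eta> else \<eta>)"
    using assms e by (auto simp: position_def intro!: c_sign_eq)
  have bks: "\<eta> * B_at B w $ k $ s < 0" and bkt: "\<eta> * B_at B w $ k $ t > 0"
    using cyc e weight_pos[of k] weight_pos[of s] weight_pos[of t]
    by (auto simp: cyclic_of_sign_def)
  show S: "S_ind B w = s"
    unfolding S_ind_def K
  proof (rule the_equality)
    show "s \<noteq> k \<and> c_sign B w s \<noteq> c_sign B w k \<and> c_sign B w s * B_at B w $ k $ s < 0"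
      using sk ne e bks by auto
  next
    fix x assume x: "x \<noteq> k \<and> c_sign B w x \<noteq> c_sign B w k \<and> c_sign B w x * B_at B w $ k $ x < 0"
    then have "x = s \<or> x = t" using UNIV_3_distinct[OF ne] by (metis UNIV_I insertE singletonD)
    then show "x = s" using x sk bkt e by (auto split: if_splits)
  qed
  show "T_ind B w = t"
    unfolding T_ind_def K S
  proof (rule the_equality)
    show "t \<noteq> k \<and> t \<noteq> s" using ne by auto
  next
    fix x assume "x \<noteq> k \<and> x \<noteq> s"
    then show "x = t" using UNIV_3_distinct[OF ne] by (metis UNIV_I insertE singletonD)
  qed
qed

text \<open>
  The sum \<open>c\<^sub>K + c\<^sub>S\<close> does not change here, because \<open>(c\<^sub>K, c\<^sub>S)\<close> becomes \<open>(- c\<^sub>S, c\<^sub>K + 2 c\<^sub>S)\<close>;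
  reversing the cycle is compensated by exchanging \<open>k\<close> and \<open>s\<close>.
\<close>

lemma position_S:
  assumes pos: "position br w \<eta> k s t"
  shows "position br (w @ [s]) \<eta> s k t"
proof -
  have cyc: "cyclic_of_sign d (B_at B w) \<eta> k s t" and sgn: "has_sign \<eta> (c_mod B d w s)"
    and dual: "dual_relations B d w \<eta> k s t"
    using pos by (auto simp: position_def)
  have e: "\<eta> = 1 \<or> \<eta> = - 1" using cyc by (auto simp: cyclic_of_sign_def)
  note c = mutation_c[OF cyc sgn]
  have "cyclic_of_sign d (B_at B (w @ [s])) \<eta> s k t"
    using cyclic_of_sign_swap[OF cyclic_of_sign_uminus[OF cyc]] by (simp add: B_at_snoc)
  moreover have "dual_relations B d (w @ [s]) \<eta> s k t"
    using dual_relations_swap[OF mutation_dual[OF cyc sgn dual]] by simp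
  moreover have "has_sign \<eta> (c_mod B d (w @ [s]) k)"
    using has_sign_add[OF sgn _ e, of "c_mod B d w k + c_mod B d w s"] pos
    by (simp add: c position_def scaleR_2 add.assoc)
  moreover have "has_sign (- \<eta>) (c_mod B d (w @ [s]) s)"
    using has_sign_uminus[OF sgn] by (simp add: c)
  ultimately show ?thesis
    using pos by (simp add: position_def c scaleR_2 add.commute)
qed

text \<open>
  Since \<open>c\<^sub>t\<close> has the sign of \<open>c\<^sub>s\<close>, the mutation adds it to \<open>c\<^sub>s\<close>, leaving \<open>c\<^sub>k\<close> alone; \<open>k\<close>
  becomes the third index and its sign now agrees with that of the new last index.
\<close>

lemma position_T_trunk:
  assumes pos: "position False w \<eta> k s t"
  shows "position True (w @ [t]) \<eta> t s k"
proof -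
  have cyc: "cyclic_of_sign d (B_at B w) \<eta> s t k" and sgn: "has_sign \<eta> (c_mod B d w t)"
    and dual: "dual_relations B d w \<eta> s t k" and ss: "has_sign \<eta> (c_mod B d w s)"
    using pos by (auto simp: position_def intro: cyclic_of_sign_rotate dual_relations_rotate)
  have e: "\<eta> = 1 \<or> \<eta> = - 1" using cyc by (auto simp: cyclic_of_sign_def)
  note c = mutation_c[OF cyc sgn]
  have st: "has_sign \<eta> (c_mod B d w s + c_mod B d w t)"
    using has_sign_add[OF sgn _ e] ss by (simp add: has_sign_def)
  have "cyclic_of_sign d (B_at B (w @ [t])) \<eta> t s k"
    using cyclic_of_sign_swap[OF cyclic_of_sign_uminus[OF cyc]] by (simp add: B_at_snoc)
  moreover have "dual_relations B d (w @ [t]) \<eta> t s k"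
    using dual_relations_swap[OF mutation_dual[OF cyc sgn dual]] by simp
  moreover have "has_sign \<eta> (c_mod B d (w @ [t]) s)"
    using has_sign_add[OF sgn _ e, of "c_mod B d w s + c_mod B d w t"] st
    by (simp add: c has_sign_def scaleR_2 add.assoc)
  moreover have "has_sign (- \<eta>) (c_mod B d (w @ [t]) t)"
    using has_sign_uminus[OF sgn] by (simp add: c)
  ultimately show ?thesis
    using pos st by (simp add: position_def c scaleR_2 has_sign_def add.commute)
qed

text \<open>
  Here \<open>c\<^sub>t\<close> has the sign of \<open>c\<^sub>k\<close> and is added to \<open>c\<^sub>k\<close>, so \<open>k\<close> becomes the new \<open>S\<close> and the
  reference sign flips.
\<close>

lemma position_T_branch:
  assumes pos: "position True w \<eta> k s t"
  shows "position True (w @ [t]) (- \<eta>) t k s"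
proof -
  have cyc0: "cyclic_of_sign d (B_at B w) \<eta> t k s" and sgn: "has_sign (- \<eta>) (c_mod B d w t)"
    and dual0: "dual_relations B d w \<eta> t k s" and sk: "has_sign (- \<eta>) (c_mod B d w k)"
    using pos by (auto simp: position_def intro: cyclic_of_sign_rotate dual_relations_rotate)
  note cyc = cyclic_of_sign_swap[OF cyc0] and dual = dual_relations_swap[OF dual0]
  have e: "- \<eta> = 1 \<or> - \<eta> = - 1" using cyc by (simp add: cyclic_of_sign_def)
  note c = mutation_c[OF cyc sgn]
  have st: "has_sign (- \<eta>) (c_mod B d w k + c_mod B d w t)"
    using has_sign_add[OF sgn _ e] sk by (simp add: has_sign_def)
  have "cyclic_of_sign d (B_at B (w @ [t])) (- \<eta>) t k s"
    using cyclic_of_sign_uminus[OF cyc0] by (simp add: B_at_snoc)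
  moreover have "dual_relations B d (w @ [t]) (- \<eta>) t k s"
    using dual_relations_swap[OF mutation_dual[OF cyc sgn dual]] by simp
  moreover have "has_sign (- \<eta>) (c_mod B d (w @ [t]) k)"
    using has_sign_add[OF sgn _ e, of "c_mod B d w k + c_mod B d w t"] st
    by (simp add: c has_sign_def scaleR_2 add.assoc)
  moreover have "has_sign \<eta> (c_mod B d (w @ [t]) t)"
    using has_sign_uminus[OF sgn] by (simp add: c)
  ultimately show ?thesis
    using pos st by (simp add: position_def c scaleR_2 has_sign_def add.commute)
qed

lemma frame_of_position:
  "position br w \<eta> k s t \<Longrightarrow> frame B d w = (g_mod B d w k, g_mod B d w s, g_mod B d w t)"
  by (simp add: frame_def position_indices)

definition phase :: "bool \<Rightarrow> 3 list \<Rightarrow> bool" where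
  "phase br w \<longleftrightarrow> (\<exists>\<eta> k s t. position br w \<eta> k s t)"

lemma phase_step:
  assumes "phase br w"
  shows "phase (br \<or> M = LetT) (act1 B w M)"
    and "frame B d (act1 B w M) = next_frame br M (frame B d w)"
proof -
  from assms obtain \<eta> k s t where pos: "position br w \<eta> k s t" by (auto simp: phase_def)
  have cyc: "cyclic_of_sign d (B_at B w) \<eta> k s t" and dual: "dual_relations B d w \<eta> k s t"
    and ss: "has_sign \<eta> (c_mod B d w s)" and st: "has_sign (if br then - \<eta> else \<eta>) (c_mod B d w t)"
    using pos by (auto simp: position_def)
  note ind = position_indices[OF pos]
  have "phase (br \<or> M = LetT) (act1 B w M) \<and> frame B d (act1 B w M) = next_frame br M (frame B d w)"
  proof (cases M)
    case LetS
    note new = position_S[OF pos]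
    have "frame B d (w @ [s]) = next_frame br LetS (frame B d w)"
      unfolding frame_of_position[OF new] frame_of_position[OF pos]
      by (simp add: mutation_g[OF cyc ss dual])
    then show ?thesis using new LetS by (auto simp: phase_def ind)
  next
    case LetT
    show ?thesis
    proof (cases br)
      case False
      then have pos': "position False w \<eta> k s t" and st': "has_sign \<eta> (c_mod B d w t)"
        using pos st by simp_all
      note new = position_T_trunk[OF pos']
      have "frame B d (w @ [t]) = next_frame False LetT (frame B d w)"
        unfolding frame_of_position[OF new] frame_of_position[OF pos]
        by (simp add: mutation_g[OF cyclic_of_sign_rotate[OF cyc] st' dual_relations_rotate[OF dual]])
      then show ?thesis using new LetT False by (auto simp: phase_def ind)
    next
      case True
      then have pos': "position True w \<eta> k s t" and st': "has_sign (- \<eta>) (c_mod B d w t)"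
        using pos st by simp_all
      note new = position_T_branch[OF pos']
      have "frame B d (w @ [t]) = next_frame True LetT (frame B d w)"
        unfolding frame_of_position[OF new] frame_of_position[OF pos]
        by (simp add: mutation_g[OF cyclic_of_sign_swap[OF cyclic_of_sign_rotate[OF cyclic_of_sign_rotate[OF cyc]]]
              st' dual_relations_swap[OF dual_relations_rotate[OF dual_relations_rotate[OF dual]]]])
      then show ?thesis using new LetT True by (auto simp: phase_def ind)
    qed
  qed
  then show "phase (br \<or> M = LetT) (act1 B w M)"
    and "frame B d (act1 B w M) = next_frame br M (frame B d w)" by auto
qed

text \<open>
  The first mutation meets the positive vector \<open>c\<^sub>i = e\<^sub>i\<close>, so it needs the cycle through \<open>i\<close>
  written with sign \<open>1\<close>; reading the cycle backwards adjusts the sign.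
\<close>

lemma cyclic_through:
  obtains s t where "cyclic_of_sign d B 1 s i t"
proof -
  from B_cyclic obtain \<eta> where c: "cyclic_of_sign d B \<eta> 1 2 3" by blast
  then have e: "\<eta> = 1 \<or> \<eta> = - 1" by (simp add: cyclic_of_sign_def)
  have "\<exists>s t. cyclic_of_sign d B \<eta> s i t"
    using exhaust_3[of i] c cyclic_of_sign_rotate by metis
  then obtain s t where st: "cyclic_of_sign d B \<eta> s i t" by blast
  show ?thesis
  proof (cases "\<eta> = 1")
    case True
    then show ?thesis using st that by blast
  next
    case False
    then have "cyclic_of_sign d B 1 t i s"
      using e cyclic_of_sign_rotate[OF cyclic_of_sign_rotate[OF cyclic_of_sign_swap[OF st]]]
        cyclic_of_sign_rotate[OF cyclic_of_sign_swap[OF st]] cyclic_of_sign_swap[OF st] by auto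
    then show ?thesis using that by blast
  qed
qed

lemma initial:
  shows phase_initial: "phase False [i]"
    and frame_initial: "frame B d [i] =
      (2 *\<^sub>R e_mod d (S_ind B [i]) - e_mod d i, e_mod d (S_ind B [i]), e_mod d (T_ind B [i]))"
    and determining_initial: "determining (e_mod d i, e_mod d (S_ind B [i]), e_mod d (T_ind B [i]))"
proof -
  obtain s t where cycB: "cyclic_of_sign d B 1 s i t" by (rule cyclic_through)
  then have cyc: "cyclic_of_sign d (B_at B []) 1 s i t" by (simp add: B_at_def)
  have ne: "s \<noteq> i" "i \<noteq> t" "t \<noteq> s" using cyc by (auto simp: cyclic_of_sign_def)
  have c0: "c_mod B d [] j = weight d j *\<^sub>R axis j 1" for j
    by (simp add: c_mod_def c_vec_def C_mat_Nil column_def mat_def vec_eq_iff axis_def)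
  have g0: "g_mod B d [] j = e_mod d j" for j
    by (simp add: g_mod_def e_mod_def g_vec_def G_mat_Nil column_def mat_def vec_eq_iff axis_def)
  have e0: "e_mod d j = weight d j *\<^sub>R axis j 1" for j by (simp add: e_mod_def weight_def)
  have s0: "has_sign 1 (c_mod B d [] j)" for j
    using weight_pos[of j] by (auto simp: c0 has_sign_def axis_def vec_eq_iff)
  have col: "B *v c_mod B d [] j = weight d j *\<^sub>R column j B" for j
    by (simp add: c0 matrix_vector_mult_scaleR matrix_vector_mult_basis)
  have dual: "dual_relations B d [] 1 s i t"
    using cycB weight_pos[of s] weight_pos[of i] weight_pos[of t] UNIV_3_distinct[OF ne]
    unfolding dual_relations_def col g0 e0 vec_eq_iff
    by (auto simp: cyclic_of_sign_def column_def axis_def)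
  note c = mutation_c[OF cyc s0] and g = mutation_g[OF cyc s0 dual]
  have "has_sign 1 (c_mod B d [] i + c_mod B d [] s + c_mod B d [] i)"
    and si: "has_sign 1 (c_mod B d [] i + c_mod B d [] s)"
    using s0 by (intro has_sign_add; simp add: has_sign_def)+
  then have "has_sign 1 (c_mod B d [i] s)" using c by (simp add: scaleR_2 add_ac)
  moreover have "has_sign (- 1) (c_mod B d [i] i)" using c has_sign_uminus[OF s0] by simp
  moreover have "has_sign 1 (c_mod B d [i] t)" using c s0 by simp
  moreover have "cyclic_of_sign d (B_at B [i]) 1 i s t"
    using cyclic_of_sign_swap[OF cyclic_of_sign_uminus[OF cyc]] B_at_snoc[of B "[]" i] by simp
  moreover have "dual_relations B d [i] 1 i s t"
    using dual_relations_swap[OF mutation_dual[OF cyc s0 dual]] by simp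
  moreover have "\<forall>j. 0 \<le> 1 * (c_mod B d [i] i + c_mod B d [i] s) $ j"
    using si c by (simp add: has_sign_def scaleR_2 add.commute)
  ultimately have pos: "position False [i] 1 i s t" by (simp add: position_def)
  then show "phase False [i]" by (auto simp: phase_def)
  note ind = position_indices[OF pos]
  show "frame B d [i] =
      (2 *\<^sub>R e_mod d (S_ind B [i]) - e_mod d i, e_mod d (S_ind B [i]), e_mod d (T_ind B [i]))"
    using g by (simp add: frame_of_position[OF pos] ind g0)
  show "determining (e_mod d i, e_mod d (S_ind B [i]), e_mod d (T_ind B [i]))"
    unfolding ind using ne by (intro determining_e_mod d_pos) auto
qed

section \<open>Linear maps between frames\<close>

lemma act_Nil [simp]: "act B w [] = w"
  and act_Cons [simp]: "act B w (M # X) = act B (act1 B w M) X"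
  and act_append: "act B w (X @ Y) = act B (act B w X) Y"
  by (simp_all add: act_def)

lemma phase_act: "phase br w \<Longrightarrow> phase (br \<or> LetT \<in> set X) (act B w X)"
proof (induction X arbitrary: br w)
  case (Cons M X)
  then show ?case using Cons.IH[OF phase_step(1)[OF Cons.prems, of M]]
    by (simp add: eq_commute[of M])
qed simp

lemma determining_act:
  "phase br w \<Longrightarrow> determining (frame B d w) \<Longrightarrow> determining (frame B d (act B w X))"
proof (induction X arbitrary: br w)
  case (Cons M X)
  then show ?case
    unfolding act_Cons by (intro Cons.IH[OF phase_step(1)[OF Cons.prems(1)]])
      (simp add: phase_step(2) determining_next)
qed simp

lemma frame_invariant_act:
  "phase br w \<Longrightarrow> frame_invariant (br \<or> LetT \<in> set X) (frame B d (act B w X)) = frame_invariant br (frame B d w)"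
proof (induction X arbitrary: br w)
  case (Cons M X)
  have "frame_invariant ((br \<or> M = LetT) \<or> LetT \<in> set X) (frame B d (act B (act1 B w M) X))
     = frame_invariant (br \<or> M = LetT) (frame B d (act1 B w M))"
    by (rule Cons.IH[OF phase_step(1)[OF Cons.prems]])
  also have "\<dots> = frame_invariant br (frame B d w)"
    by (simp only: phase_step(2)[OF Cons.prems] frame_invariant_next)
  finally show ?case by (simp add: eq_commute[of M])
qed simp

lemma map_frame_act:
  assumes "linear f" "phase br w" "phase br w'" "map_frame f (frame B d w) = frame B d w'"
  shows "map_frame f (frame B d (act B w Y)) = frame B d (act B w' Y)"
  using assms(2-)
proof (induction Y arbitrary: br w w')
  case (Cons M Y)
  show ?case
    unfolding act_Cons
    by (rule Cons.IH[OF phase_step(1)[OF Cons.prems(1)] phase_step(1)[OF Cons.prems(2)]])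
       (simp only: phase_step(2)[OF Cons.prems(1)] phase_step(2)[OF Cons.prems(2)]
          map_frame_next[OF assms(1)] Cons.prems(3))
qed simp

lemma determining_frame: "determining (frame B d (act B [i] X))"
proof -
  (* The frame of [i] is what a step S makes of the rescaled unit vectors with the roles of
     K and S exchanged. *)
  have "frame B d [i] = next_frame False LetS (e_mod d (S_ind B [i]), e_mod d i, e_mod d (T_ind B [i]))"
    by (simp add: frame_initial)
  moreover have "determining (e_mod d (S_ind B [i]), e_mod d i, e_mod d (T_ind B [i]))"
    using determining_initial[of i] unfolding determining_def prod.case by metis
  ultimately have "determining (frame B d [i])" by (simp only: determining_next)
  then show ?thesis by (rule determining_act[OF phase_initial])
qed

lemma Psi_spec:
  "linear (Psi B d (act B [i] Y) X) \<and>
   map_frame (Psi B d (act B [i] Y) X) (frame B d (act B [i] Y)) = frame B d (act B [i] (Y @ X))"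
  using theI'[of "\<lambda>f. linear f
        \<and> f (g_mod B d (act B [i] Y) (K_ind (act B [i] Y))) = g_mod B d (act B [i] (Y @ X)) (K_ind (act B [i] (Y @ X)))
        \<and> f (g_mod B d (act B [i] Y) (S_ind B (act B [i] Y))) = g_mod B d (act B [i] (Y @ X)) (S_ind B (act B [i] (Y @ X)))
        \<and> f (g_mod B d (act B [i] Y) (T_ind B (act B [i] Y))) = g_mod B d (act B [i] (Y @ X)) (T_ind B (act B [i] (Y @ X)))"]
    determining_frame[of i Y]
  by (simp add: determining_def Psi_def frame_def map_frame_def act_append)

lemma Psi1_spec:
  "linear (Psi1 B d i) \<and>
   map_frame (Psi1 B d i) (e_mod d i, e_mod d (S_ind B [i]), e_mod d (T_ind B [i]))
     = (e_mod d (S_ind B [i]), 2 *\<^sub>R e_mod d (S_ind B [i]) - e_mod d i, e_mod d (T_ind B [i]))"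
  using theI'[of "\<lambda>f. linear f
        \<and> f (e_mod d (K_ind [i])) = e_mod d (S_ind B [i])
        \<and> f (e_mod d (S_ind B [i])) = - e_mod d (K_ind [i]) + 2 *\<^sub>R e_mod d (S_ind B [i])
        \<and> f (e_mod d (T_ind B [i])) = e_mod d (T_ind B [i])"]
    determining_initial[of i]
  by (simp add: determining_def Psi1_def K_ind_def map_frame_def)

lemmas Psi_linear = conjunct1[OF Psi_spec]
  and Psi1_linear = conjunct1[OF Psi1_spec]

lemma g_frak_invariant: "frame_invariant (LetT \<in> set X) (frame B d (act B [i] X)) = g_frak B d i"
  using frame_invariant_act[OF phase_initial, of X i]
  by (simp add: frame_initial g_frak_def K_ind_def scaleR_2)

text \<open>
  The difference of the two generators is \<open>\<gg>\<^sub>i\<close>, so \<open>F\<^sub>i\<close> has the shape of a cone \<open>\<phi>(w)\<close>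
  with \<open>e\<^sub>S\<close> in place of \<open>g\<^sub>K\<close>.
\<close>

lemma F_cone_eq: "F_cone B d i = open_cone [e_mod d (S_ind B [i]), e_mod d (S_ind B [i]) - g_frak B d i]"
  by (simp add: F_cone_def g_frak_def)

lemma hd_act: "w \<noteq> [] \<Longrightarrow> hd (act B w X) = hd w"
proof (induction X arbitrary: w)
  case (Cons M X)
  then show ?case by (cases M) auto
qed simp

lemma phi_act: "phi B d (act B [i] X) =
    open_cone [fst (frame B d (act B [i] X)), fst (frame B d (act B [i] X)) - g_frak B d i]"
  by (simp add: phi_def frame_def hd_act)

lemma Psi_g_frak:
  assumes "LetT \<in> set Y"
  shows "Psi B d (act B [i] Y) X (g_frak B d i) = g_frak B d i"
  using map_frame_invariant[of "Psi B d (act B [i] Y) X" True "frame B d (act B [i] Y)"]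
    Psi_spec[of i Y X] g_frak_invariant[of Y i] g_frak_invariant[of "Y @ X" i] assms by simp

lemma Psi1_g_frak: "Psi1 B d i (g_frak B d i) = g_frak B d i"
  using Psi1_spec[of i]
  by (simp add: g_frak_def K_ind_def map_frame_def linear_add linear_diff scaleR_2)

lemma Psi_frame:
  assumes "LetT \<in> set Y"
  shows "map_frame (Psi B d (act B [i] Y) X) (frame B d (act B [i] (Y @ Z)))
    = frame B d (act B [i] (Y @ X @ Z))"
proof -
  have "map_frame (Psi B d (act B [i] Y) X) (frame B d (act B (act B [i] Y) Z))
      = frame B d (act B (act B [i] (Y @ X)) Z)"
    using phase_act[OF phase_initial, of Y i] phase_act[OF phase_initial, of "Y @ X" i] assms Psi_spec[of i Y X]
    by (intro map_frame_act[where br = True]) auto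
  then show ?thesis by (simp add: act_append)
qed

lemma Psi1_frame:
  "map_frame (Psi1 B d i) (frame B d (act B [i] Z)) = frame B d (act B [i] (LetS # Z))"
proof -
  have "map_frame (Psi1 B d i) (frame B d [i]) = frame B d (act1 B [i] LetS)"
    using Psi1_spec[of i] unfolding phase_step(2)[OF phase_initial] frame_initial
    by (simp add: map_frame_def linear_diff linear_scale)
  then show ?thesis
    using map_frame_act[OF _ phase_initial phase_step(1)[OF phase_initial, of LetS i, simplified]] Psi1_spec[of i]
    by simp
qed

section \<open>Images of the cones\<close>

lemma Psi_phi:
  assumes "LetT \<in> set Y"
  shows "Psi B d (act B [i] Y) X ` phi B d (act B [i] (Y @ Z)) = phi B d (act B [i] (Y @ X @ Z))"
proof -
  have "Psi B d (act B [i] Y) X (fst (frame B d (act B [i] (Y @ Z)))) = fst (frame B d (act B [i] (Y @ X @ Z)))"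
    using Psi_frame[OF assms, of i X Z] by (auto simp: map_frame_def prod_eq_iff)
  then show ?thesis
    by (simp add: phi_act linear_image_open_cone[OF Psi_linear] linear_diff[OF Psi_linear] Psi_g_frak[OF assms])
qed

lemma Psi1_phi: "Psi1 B d i ` phi B d (act B [i] Z) = phi B d (act B [i] (LetS # Z))"
proof -
  have "Psi1 B d i (fst (frame B d (act B [i] Z))) = fst (frame B d (act B [i] (LetS # Z)))"
    using Psi1_frame[of i Z] by (auto simp: map_frame_def prod_eq_iff simp del: act_Cons)
  then show ?thesis
    by (simp add: phi_act linear_image_open_cone[OF Psi1_linear] linear_diff[OF Psi1_linear] Psi1_g_frak del: act_Cons)
qed

lemma Psi1_F_cone: "Psi1 B d i ` F_cone B d i = phi B d [i]"
proof -
  have "Psi1 B d i (e_mod d (S_ind B [i])) = 2 *\<^sub>R e_mod d (S_ind B [i]) - e_mod d i"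
    using Psi1_spec[of i] by (simp add: map_frame_def)
  then show ?thesis
    using phi_act[of i "[]"]
    by (simp add: F_cone_eq linear_image_open_cone[OF Psi1_linear] linear_diff[OF Psi1_linear] Psi1_g_frak frame_initial)
qed

lemma Psi1_power_phi: "(Psi1 B d i ^^ n) ` phi B d (act B [i] Z) = phi B d (act B [i] (replicate n LetS @ Z))"
proof (induction n)
  case (Suc n)
  have "(Psi1 B d i ^^ Suc n) ` phi B d (act B [i] Z) = Psi1 B d i ` phi B d (act B [i] (replicate n LetS @ Z))"
    by (simp only: funpow.simps image_comp[symmetric] Suc.IH)
  then show ?case by (simp only: Psi1_phi replicate_Suc append_Cons)
qed simp

lemma Psi1_power_F_cone: "(Psi1 B d i ^^ Suc n) ` F_cone B d i = phi B d (act B [i] (replicate n LetS))"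
proof -
  have "(Psi1 B d i ^^ Suc n) ` F_cone B d i = (Psi1 B d i ^^ n) ` phi B d (act B [i] [])"
    by (simp only: funpow_Suc_right image_comp[symmetric] Psi1_F_cone act_Nil)
  then show ?thesis by (simp only: Psi1_power_phi append_Nil2)
qed

text \<open>
  In a branch the letter \<open>T\<close> moves \<open>g\<^sub>K\<close> into the slot of \<open>g\<^sub>S\<close>; this brings a cone over \<open>g\<^sub>S\<close> to the
  cone over \<open>g\<^sub>K\<close>.
\<close>

lemma Psi_T_of_S_frame:
  assumes Y: "LetT \<in> set Y"
  shows "Psi B d (act B [i] Y) [LetT] (fst (snd (frame B d (act B [i] Y)))) = fst (frame B d (act B [i] Y))"
proof -
  have "phase True (act B [i] Y)" using phase_act[OF phase_initial, of Y i] Y by simp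
  from phase_step(2)[OF this, of LetT]
  have "fst (snd (frame B d (act B [i] (Y @ [LetT])))) = fst (frame B d (act B [i] Y))"
    by (cases "frame B d (act B [i] Y)") (simp add: act_append)
  then show ?thesis using Psi_spec[of i Y "[LetT]"] by (auto simp: map_frame_def prod_eq_iff)
qed

lemma Psi_T_F_cone:
  "Psi B d (act B [i] [LetT]) [LetT] ` F_cone B d i = phi B d (act B [i] [LetT])"
proof -
  let ?P = "Psi B d (act B [i] [LetT]) [LetT]"
  have "fst (snd (frame B d (act B [i] [LetT]))) = e_mod d (S_ind B [i])"
    using phase_step(2)[OF phase_initial, of i LetT] by (simp add: frame_initial)
  then have "?P (e_mod d (S_ind B [i])) = fst (frame B d (act B [i] [LetT]))"
    using Psi_T_of_S_frame[of "[LetT]" i] by (simp del: act_Cons)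
  then show ?thesis
    using Psi_g_frak[of "[LetT]" i "[LetT]"]
    by (simp add: F_cone_eq phi_act linear_image_open_cone[OF Psi_linear] linear_diff[OF Psi_linear] del: act_Cons)
qed

lemma Psi_T_phi:
  "Psi B d (act B [i] (replicate (Suc n) LetS @ [LetT])) [LetT] ` phi B d (act B [i] (replicate n LetS))
     = phi B d (act B [i] (replicate (Suc n) LetS @ [LetT]))"
proof -
  let ?Y = "replicate (Suc n) LetS @ [LetT]"
  let ?v = "act B [i] (replicate n LetS)"
  have v: "phase False ?v" using phase_act[OF phase_initial, of "replicate n LetS" i] by simp
  have Y: "act B [i] ?Y = act1 B (act1 B ?v LetS) LetT"
    by (simp only: act_append act_Cons act_Nil replicate_Suc replicate_append_same[symmetric])
  (* The step S stores the old g_K as g_S, and the first step T keeps g_S. *)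
  have "fst (snd (frame B d (act B [i] ?Y))) = fst (frame B d ?v)"
    unfolding Y phase_step(2)[OF v] phase_step(2)[OF phase_step(1)[OF v]]
    by (cases "frame B d ?v") simp
  then have "Psi B d (act B [i] ?Y) [LetT] (fst (frame B d ?v)) = fst (frame B d (act B [i] ?Y))"
    using Psi_T_of_S_frame[of ?Y i] by (simp del: act_Cons replicate_Suc)
  then show ?thesis
    using Psi_g_frak[of ?Y i "[LetT]"]
    by (simp add: phi_act linear_image_open_cone[OF Psi_linear] linear_diff[OF Psi_linear] del: act_Cons replicate_Suc)
qed

text \<open>
  The outermost map inserts its letter directly after \<open>[i]T\<close>, in front of the letters inserted
  before; hence the letters appear in the order of the maps.
\<close>

lemma Psi_composite_phi:
  "foldr (\<circ>) (map (\<lambda>M. Psi B d (act B [i] [LetT]) [M]) Ms) id ` phi B d (act B [i] [LetT])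
     = phi B d (act B [i] (LetT # Ms))"
proof (induction Ms)
  case (Cons M Ms)
  have "foldr (\<circ>) (map (\<lambda>M. Psi B d (act B [i] [LetT]) [M]) (M # Ms)) id ` phi B d (act B [i] [LetT])
     = Psi B d (act B [i] [LetT]) [M] ` phi B d (act B [i] (LetT # Ms))"
    by (simp only: list.map foldr.simps o_apply image_comp[symmetric] Cons.IH)
  also have "\<dots> = phi B d (act B [i] ([LetT] @ [M] @ Ms))"
    using Psi_phi[of "[LetT]" i "[M]" Ms] by (simp del: act_Cons)
  finally show ?case by (simp only: append_Cons append_Nil)
qed simp

text \<open>
  In a reduced word each letter differs from its predecessor \<open>K\<close>, so it is \<open>S\<close> or \<open>T\<close>.
\<close>

lemma T_ge_act:
  assumes "w \<in> T_ge i"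
  shows "\<exists>X. w = act B [i] X"
proof -
  have "w \<noteq> [] \<Longrightarrow> reduced w \<Longrightarrow> \<exists>X. w = act B [hd w] X"
  proof (induction w rule: rev_induct)
    case (snoc k v)
    show ?case
    proof (cases "v = []")
      case True
      then show ?thesis by (intro exI[of _ "[]"]) simp
    next
      case False
      have "reduced v" unfolding reduced_def
      proof (intro allI impI)
        fix j assume "Suc j < length v"
        then show "v ! j \<noteq> v ! Suc j"
          using snoc.prems(2) unfolding reduced_def by (auto dest!: spec[of _ j] simp: nth_append)
      qed
      then obtain X where X: "v = act B [hd v] X" using snoc.IH False by blast
      have "k \<noteq> last v"
        using snoc.prems(2) False unfolding reduced_def
        by (auto dest!: spec[of _ "length v - 1"] simp: nth_append last_conv_nth)
      obtain br \<eta> k' s t where pos: "position br v \<eta> k' s t"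
        using phase_act[OF phase_initial, of X "hd v"] X by (auto simp: phase_def)
      then have "k' \<noteq> s" "s \<noteq> t" "t \<noteq> k'" "last v = k'"
        by (auto simp: position_def cyclic_of_sign_def)
      with \<open>k \<noteq> last v\<close> have "k = s \<or> k = t"
        using UNIV_3_distinct[of k' s t] by (metis UNIV_I insertE singletonD)
      then obtain M where "v @ [k] = act1 B v M"
        using position_indices[OF pos] by (metis act1.simps)
      then have "v @ [k] = act B [hd v] (X @ [M])" using X by (simp add: act_append)
      then show ?thesis using False by (metis hd_append2)
    qed
  qed simp
  then show ?thesis using assms by (auto simp: T_ge_def)
qed

lemma letters_cases:
  "(\<exists>n. X = replicate n LetS) \<or> (\<exists>n Ms. X = replicate n LetS @ [LetT] @ Ms)"
proof (induction X)
  case (Cons M X)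
  show ?case
  proof (cases M)
    case LetS
    from Cons.IH show ?thesis
      unfolding LetS by (metis append_Cons replicate_Suc)
  next
    case LetT
    then show ?thesis by (metis append_Cons append_Nil replicate_0)
  qed
qed simp

end

section \<open>Skew-symmetrizable matrices of the given type\<close>

text \<open>
  Multiplying \<open>a x = b y\<close> by \<open>x\<close> gives \<open>a x\<^sup>2 = 4 b\<close>.
\<close>

lemma entry_of_symmetrizer:
  fixes x y a b :: real
  assumes "x > 0" "y > 0" "a > 0" "b > 0" "x * y = 4" "a * x = b * y"
  shows "x = 2 * a powr (- 1 / 2) / b powr (- 1 / 2)"
proof -
  have "a * x\<^sup>2 = 4 * b"
    using assms(5,6) by (metis mult.assoc mult.commute power2_eq_square)
  then have "x\<^sup>2 = 4 * (b / a)" using assms by (simp add: field_simps)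
  then have "x = sqrt (4 * (b / a))" using assms(1) by (simp add: real_sqrt_unique)
  also have "\<dots> = 2 * (sqrt b / sqrt a)" by (simp add: real_sqrt_mult real_sqrt_divide)
  finally show ?thesis
    using assms by (simp add: powr_minus powr_half_sqrt field_simps)
qed

lemma markov_type_b_mat:
  fixes p p' q q' r r' :: real and B :: "real^3^3" and d :: "real^3"
  assumes pos: "p > 0" "p' > 0" "q > 0" "q' > 0" "r > 0" "r' > 0"
    and prod: "p * p' = 4" "q * q' = 4" "r * r' = 4"
    and B: "B = b_mat p p' q q' r r' \<or> B = - b_mat p p' q q' r r'"
    and d: "\<And>j. d $ j > 0"
    and skew: "transpose (diag_mat d ** B) = - (diag_mat d ** B)"
  shows "markov_type B d"
proof
  let ?A = "b_mat p p' q q' r r'"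
  have A: "?A $ 1 $ 1 = 0" "?A $ 1 $ 2 = - p'" "?A $ 1 $ 3 = r" "?A $ 2 $ 1 = p" "?A $ 2 $ 2 = 0"
    "?A $ 2 $ 3 = - q'" "?A $ 3 $ 1 = - r'" "?A $ 3 $ 2 = q" "?A $ 3 $ 3 = 0"
    by (simp_all add: b_mat_def)
  have DB: "(diag_mat d ** B) $ i $ j = d $ i * B $ i $ j" for i j
    by (simp add: matrix_matrix_mult_def diag_mat_def if_distrib[of "\<lambda>x. x * _"] cong: if_cong)
  have sk: "d $ j * B $ j $ i = - (d $ i * B $ i $ j)" for i j
    using skew[unfolded vec_eq_iff, rule_format, of i j] by (simp add: transpose_def DB)
  have skA: "d $ j * ?A $ j $ i = - (d $ i * ?A $ i $ j)" for i j
    using B sk[of j i] by auto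
  note E = entry_of_symmetrizer[OF _ _ d d, folded weight_def]
  have balance: "d $ 1 * p' = d $ 2 * p" "d $ 2 * q' = d $ 3 * q" "d $ 3 * r' = d $ 1 * r"
    using skA[of 1 2] skA[of 2 3] skA[of 1 3] by (simp_all add: A)
  have "p' = 2 * weight d 1 / weight d 2" "p = 2 * weight d 2 / weight d 1"
    using E[of p' p 1 2] E[of p p' 2 1] pos prod balance by (simp_all add: mult.commute)
  moreover have "q' = 2 * weight d 2 / weight d 3" "q = 2 * weight d 3 / weight d 2"
    using E[of q' q 2 3] E[of q q' 3 2] pos prod balance by (simp_all add: mult.commute)
  moreover have "r' = 2 * weight d 3 / weight d 1" "r = 2 * weight d 1 / weight d 3"
    using E[of r' r 3 1] E[of r r' 1 3] pos prod balance by (simp_all add: mult.commute)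
  ultimately have cA: "cyclic_of_sign d ?A 1 1 2 3"
    unfolding cyclic_of_sign_def A forall_3 by simp
  show "\<exists>\<eta>. cyclic_of_sign d B \<eta> 1 2 3"
    using B cA cyclic_of_sign_uminus[OF cA] by auto
qed (rule d)

theorem theorem8p4:
  fixes p p' q q' r r' :: real and B :: "real^3^3" and d :: "real^3" and i :: 3
  assumes "p > 0" "p' > 0" "q > 0" "q' > 0" "r > 0" "r' > 0"
    and "p * p' = 4" "q * q' = 4" "r * r' = 4"
    and "p * q * r = p' * q' * r'"
    and "B = b_mat p p' q q' r r' \<or> B = - b_mat p p' q q' r r'"
    and "\<And>j. d $ j > 0"
    and "transpose (diag_mat d ** B) = - (diag_mat d ** B)"
  shows
    "(\<forall>n\<ge>1.
        (Psi1 B d i ^^ n) ` F_cone B d i = phi B d (act B [i] (replicate (n - 1) LetS))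
      \<and> Psi B d (act B [i] [LetT]) [LetT] ` F_cone B d i = phi B d (act B [i] [LetT])
      \<and> Psi B d (act B [i] (replicate n LetS @ [LetT])) [LetT]
            ` phi B d (act B [i] (replicate (n - 1) LetS))
          = phi B d (act B [i] (replicate n LetS @ [LetT])))
    \<and> (\<forall>w\<in>T_ge i.
        ((\<exists>n. w = act B [i] (replicate n LetS))
          \<or> (\<exists>n Ms. w = act B [i] (replicate n LetS @ [LetT] @ Ms)))
      \<and> (\<forall>n. w = act B [i] (replicate n LetS) \<longrightarrow>
            phi B d w = (Psi1 B d i ^^ (n + 1)) ` F_cone B d i)
      \<and> (\<forall>n Ms. w = act B [i] (replicate n LetS @ [LetT] @ Ms) \<longrightarrow>
            phi B d w =
              ((Psi1 B d i ^^ n)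
                \<circ> foldr (\<circ>) (map (\<lambda>M. Psi B d (act B [i] [LetT]) [M]) Ms) id
                \<circ> Psi B d (act B [i] [LetT]) [LetT]) ` F_cone B d i))"
proof -
  interpret markov_type B d
    using assms by (intro markov_type_b_mat)
  have act_cases: "(\<exists>n. w = act B [i] (replicate n LetS))
      \<or> (\<exists>n Ms. w = act B [i] (replicate n LetS @ [LetT] @ Ms))" if "w \<in> T_ge i" for w
    using T_ge_act[OF that] letters_cases by metis
  have b: "phi B d (act B [i] (replicate n LetS @ [LetT] @ Ms)) =
      ((Psi1 B d i ^^ n)
        \<circ> foldr (\<circ>) (map (\<lambda>M. Psi B d (act B [i] [LetT]) [M]) Ms) id
        \<circ> Psi B d (act B [i] [LetT]) [LetT]) ` F_cone B d i" for n Ms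
    by (simp only: image_comp[symmetric] Psi_T_F_cone Psi_composite_phi Psi1_power_phi append_Cons append_Nil)
  have "(Psi1 B d i ^^ n) ` F_cone B d i = phi B d (act B [i] (replicate (n - 1) LetS))
      \<and> Psi B d (act B [i] (replicate n LetS @ [LetT])) [LetT]
            ` phi B d (act B [i] (replicate (n - 1) LetS))
          = phi B d (act B [i] (replicate n LetS @ [LetT]))" if "n \<ge> 1" for n
    using Psi1_power_F_cone[of "n - 1" i] Psi_T_phi[of i "n - 1"] that by (simp del: act_Cons replicate_Suc funpow.simps)
  then show ?thesis
    using act_cases b Psi_T_F_cone[of i] Psi1_power_F_cone[where i = i] by (metis Suc_eq_plus1)
qed

end
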